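(* Let $p$ be a prime, $q=p^s$ with $s\ge 1$, $\mathbb{A}=\mathbb{F}_q[X]$. Let $f\in\mathbb{A}$ with $\deg f\ge 1$ and let $n$ be an integer with $n\ge \deg f$. Then $$G(n,f)\equiv\begin{cases}-1\pmod f & \text{if } p \text{ is odd and } f \text{ has only one prime divisor},\\ 1\pmod f & \text{otherwise}.\end{cases}$$
   Context: For an integer $n\ge 1$ and $f\in\mathbb{A}$, $G(n,f)=\prod g$, the product over all non-zero $g\in\mathbb{A}$ with $0\le\deg g\le n$ and $\gcd(g,f)=1$. A prime divisor of $f$ is a monic irreducible polynomial dividing $f$. *)

theory Defs
  imports
    "HOL-Computational_Algebra.Computational_Algebra"
    "HOL-Library.Cardinality"
    "HOL-Number_Theory.Cong"
begin

text \<open>The field with \<open>q\<close> elements is a type of class \<open>{field, finite}\<close> with \<open>CARD('a) = q\<close>.\<close>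

text \<open>Coprimality is stated with \<^const>\<open>coprime\<close>, since \<^const>\<open>gcd\<close> on polynomials needs a class
  (\<^class>\<open>field_gcd\<close>) whose extra operations an arbitrary field type does not carry. Finiteness of
  the coefficient field makes the index set of the product finite.\<close>

definition G :: "nat \<Rightarrow> 'a::{field, finite} poly \<Rightarrow> 'a poly" where
  "G n f = (\<Prod>g\<in>{g. g \<noteq> 0 \<and> degree g \<le> n \<and> coprime g f}. g)"

definition prime_divisors :: "'a::{field, finite} poly \<Rightarrow> 'a poly set" where
  "prime_divisors f = {P. lead_coeff P = 1 \<and> irreducible P \<and> P dvd f}"

end

theory Submission
  imports Defs
begin

text \<open>Let \<open>W\<close> be the product of the units modulo \<open>f\<close>. Every unit class is represented equally often
  among the factors of \<open>G n f\<close>, namely \<open>q ^ (n - degree f + 1)\<close> times, so \<open>G n f\<close> is congruent to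
  that power of \<open>W\<close>. Cancelling each unit against its inverse shows that \<open>W\<close> is congruent to the
  product over \<open>S = {u. u\<^sup>2 = 1}\<close>, whence \<open>W\<^sup>2 = 1\<close> and only the parity of the exponent matters.
  Pairing \<open>u\<close> with \<open>t u\<close> for any \<open>t \<in> S - {1}\<close> gives \<open>W = t ^ (card S div 2)\<close>. For odd \<open>q\<close> take
  \<open>t = -1\<close>: if \<open>f\<close> has a single prime divisor, then \<open>S = {1, -1}\<close> and \<open>W = -1\<close>; otherwise the Chinese
  remainder theorem provides a second choice of \<open>t\<close>, and comparing both forces \<open>card S div 2\<close> to be
  even.\<close>

section \<open>Fixed-point-free involutions on finite sets\<close>

text \<open>Removing one orbit \<open>{x, \<phi> x}\<close> at a time, \<open>T\<close> collects one
  point from each. This reduces counts and products over \<open>S\<close> to single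
  representatives.\<close>

lemma involution_transversal:
  assumes "finite S"
    and "\<And>x. x \<in> S \<Longrightarrow> \<phi> x \<in> S \<and> \<phi> (\<phi> x) = x \<and> \<phi> x \<noteq> x"
  obtains T where "S = T \<union> \<phi> ` T" "T \<inter> \<phi> ` T = {}" "inj_on \<phi> T"
proof -
  have "\<exists>T. S = T \<union> \<phi> ` T \<and> T \<inter> \<phi> ` T = {} \<and> inj_on \<phi> T"
    using assms
  proof (induction S rule: finite_psubset_induct)
    case (psubset S)
    show ?case
    proof (cases "S = {}")
      case True
      then show ?thesis by simp
    next
      case False
      then obtain x where x: "x \<in> S" by blast
      define S' where "S' = S - {x, \<phi> x}"
      have "S' \<subset> S" using x by (auto simp: S'_def)
      moreover have "\<phi> y \<in> S' \<and> \<phi> (\<phi> y) = y \<and> \<phi> y \<noteq> y" if "y \<in> S'" for y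
        using psubset.prems[of y] psubset.prems[OF x] that unfolding S'_def
        by (metis Diff_iff insert_iff empty_iff)
      ultimately obtain T where T: "S' = T \<union> \<phi> ` T" "T \<inter> \<phi> ` T = {}" "inj_on \<phi> T"
        using psubset.IH by meson
      have S: "S = insert x (insert (\<phi> x) S')" and not_in: "x \<notin> S'" "\<phi> x \<notin> S'" "\<phi> x \<noteq> x"
        using psubset.prems[OF x] x by (auto simp: S'_def)
      have "S = insert x T \<union> \<phi> ` insert x T"
        using S T(1) by auto
      moreover have "insert x T \<inter> \<phi> ` insert x T = {}"
        using T not_in by auto
      moreover have "inj_on \<phi> (insert x T)"
        using T not_in by auto
      ultimately show ?thesis by blast
    qed
  qed
  with that show ?thesis by blast
qed

lemma even_card_involution:
  assumes "finite S"
    and "\<And>x. x \<in> S \<Longrightarrow> \<phi> x \<in> S \<and> \<phi> (\<phi> x) = x \<and> \<phi> x \<noteq> x"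
  shows "even (card S)"
proof -
  obtain T where T: "S = T \<union> \<phi> ` T" "T \<inter> \<phi> ` T = {}" "inj_on \<phi> T"
    by (rule involution_transversal[OF assms]) blast
  then have "card S = card T + card (\<phi> ` T)"
    using assms(1) by (metis card_Un_disjoint finite_Un)
  with T(3) show ?thesis by (simp add: card_image)
qed

text \<open>Each two-element orbit contributes \<open>c\<close>. It is applied to inversion, with
  \<open>c = 1\<close>, and to multiplication by a square root \<open>t\<close> of 1, with
  \<open>c = t\<close>.\<close>

lemma cong_prod_involution:
  fixes c m :: "'a::unique_euclidean_semiring"
  assumes "finite S"
    and "\<And>x. x \<in> S \<Longrightarrow> \<phi> x \<in> S \<and> \<phi> (\<phi> x) = x \<and> \<phi> x \<noteq> x"
    and "\<And>x. x \<in> S \<Longrightarrow> [x * \<phi> x = c] (mod m)"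
  shows "[\<Prod>S = c ^ (card S div 2)] (mod m)"
proof -
  obtain T where T: "S = T \<union> \<phi> ` T" "T \<inter> \<phi> ` T = {}" "inj_on \<phi> T"
    by (rule involution_transversal[OF assms(1,2)]) blast
  have fin: "finite T" using T(1) assms(1) by simp
  have "card S = card T + card (\<phi> ` T)"
    using T fin by (simp add: card_Un_disjoint)
  then have card: "card S div 2 = card T"
    using T(3) by (simp add: card_image)
  have "\<Prod>S = \<Prod>T * \<Prod>(\<phi> ` T)"
    using T(1,2) fin by (simp add: prod.union_disjoint)
  also have "\<dots> = (\<Prod>x\<in>T. x * \<phi> x)"
    using T(3) by (simp add: prod.reindex prod.distrib)
  also have "[\<dots> = (\<Prod>x\<in>T. c)] (mod m)"
    using T(1) assms(3) by (intro cong_prod) blast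
  finally show ?thesis by (simp add: card)
qed

section \<open>Bezout identities and invertibility modulo an element\<close>

text \<open>The Euclidean algorithm: the pair \<open>(a, b)\<close> is replaced by
  \<open>(b, a mod b)\<close>, which has the same common divisors.\<close>

lemma coprime_bezout:
  fixes a b :: "'a::euclidean_ring"
  assumes "coprime a b"
  obtains x y where "a * x + b * y = 1"
proof -
  have "\<exists>x y. a * x + b * y = 1"
    using assms
  proof (induction "euclidean_size b" arbitrary: a b rule: less_induct)
    case less
    show ?case
    proof (cases "b = 0")
      case True
      then have "is_unit a" using less.prems by simp
      then show ?thesis using True by (auto elim!: dvdE)
    next
      case False
      have "coprime b (a mod b)"
        using less.prems by (auto simp: coprime_def dvd_mod_iff)
      moreover have "euclidean_size (a mod b) < euclidean_size b"
        using False by (rule mod_size_less)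
      ultimately obtain x y where "b * x + (a mod b) * y = 1"
        using less.hyps by blast
      moreover have "a mod b = a - b * (a div b)"
        by (simp add: minus_mult_div_eq_mod)
      ultimately have "a * y + b * (x - (a div b) * y) = 1"
        by (simp add: algebra_simps)
      then show ?thesis by blast
    qed
  qed
  with that show ?thesis by blast
qed

text \<open>A Bezout identity read modulo \<open>m\<close>; conversely, a common divisor of
  \<open>a\<close> and \<open>m\<close> divides 1.\<close>

lemma coprime_iff_cong_inverse:
  fixes a m :: "'a::unique_euclidean_ring"
  shows "coprime a m \<longleftrightarrow> (\<exists>x. [a * x = 1] (mod m))"
proof
  assume "coprime a m"
  then obtain x y where "a * x + m * y = 1" by (rule coprime_bezout)
  then have "1 = a * x + m * y" by simp
  then show "\<exists>x. [a * x = 1] (mod m)" by (auto simp: cong_iff_lin)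
next
  assume "\<exists>x. [a * x = 1] (mod m)"
  then obtain x k where *: "1 = a * x + m * k" by (auto simp: cong_iff_lin)
  show "coprime a m"
  proof (rule coprimeI)
    fix d assume "d dvd a" "d dvd m"
    then have "d dvd a * x + m * k" by (intro dvd_add dvd_mult2)
    then show "is_unit d" by (simp flip: *)
  qed
qed

lemma coprime_cong:
  fixes a b m :: "'a::unique_euclidean_ring"
  assumes "[a = b] (mod m)"
  shows "coprime a m \<longleftrightarrow> coprime b m"
proof -
  have "[a * x = 1] (mod m) \<longleftrightarrow> [b * x = 1] (mod m)" for x
    using cong_mult[OF assms cong_refl[of x m]] by (meson cong_sym cong_trans)
  then show ?thesis by (simp add: coprime_iff_cong_inverse)
qed

text \<open>Multiply a Bezout identity for \<open>a\<close> and \<open>m\<close> by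
  \<open>b\<close>: both summands are then divisible by \<open>m\<close>.\<close>

lemma coprime_dvd_multD:
  fixes a b m :: "'a::euclidean_ring"
  assumes "coprime a m" "m dvd a * b"
  shows "m dvd b"
proof -
  obtain x y where *: "a * x + m * y = 1" using assms(1) by (rule coprime_bezout)
  have "m dvd (a * b) * x + m * (y * b)"
    by (rule dvd_add[OF dvd_mult2[OF assms(2)] dvd_triv_left])
  also have "(a * b) * x + m * (y * b) = (a * x + m * y) * b" by (simp add: algebra_simps)
  finally show ?thesis by (simp add: *)
qed

section \<open>Irreducible factors of polynomials over a field\<close>

text \<open>A proper factor has smaller degree, so descent reaches an irreducible one; scaling by a
  constant unit makes it monic.\<close>

lemma monic_irreducible_divisor_exists:
  fixes a :: "'a::field poly"
  assumes "a \<noteq> 0" "\<not> is_unit a"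
  obtains P where "lead_coeff P = 1" "irreducible P" "P dvd a"
proof -
  have "\<exists>P. irreducible P \<and> P dvd a"
    using assms
  proof (induction "degree a" arbitrary: a rule: less_induct)
    case less
    show ?case
    proof (cases "irreducible a")
      case True
      then show ?thesis by auto
    next
      case False
      then obtain b c where bc: "a = b * c" "\<not> is_unit b" "\<not> is_unit c"
        using less.prems by (auto simp: irreducible_def)
      then have nz: "b \<noteq> 0" "c \<noteq> 0" using less.prems by auto
      then have "degree c > 0" using bc(3) by (simp add: is_unit_iff_degree)
      then have "degree b < degree a" using bc nz by (simp add: degree_mult_eq)
      then show ?thesis using less.hyps nz bc by (metis dvd_mult2)
    qed
  qed
  then obtain P where P: "irreducible P" "P dvd a" by blast
  then have "lead_coeff P \<noteq> 0" by auto
  define Q where "Q = smult (inverse (lead_coeff P)) P"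
  have unit: "is_unit [:inverse (lead_coeff P):]"
    using \<open>lead_coeff P \<noteq> 0\<close> by (simp add: is_unit_pCons_iff)
  have Q: "Q = [:inverse (lead_coeff P):] * P" by (simp add: Q_def)
  have "lead_coeff Q = 1" using \<open>lead_coeff P \<noteq> 0\<close> by (simp add: Q_def)
  moreover have "irreducible Q"
    unfolding Q using P(1) unit by (simp only: irreducible_mult_unit_left)
  moreover have "Q dvd a"
    unfolding Q using P(2) unit by (simp only: mult_unit_dvd_iff')
  ultimately show ?thesis by (rule that)
qed

text \<open>Dividing out \<open>P\<close> lowers the degree, so it stops. The result supplies the
  two coprime factors for the Chinese remainder argument.\<close>

lemma irreducible_power_decompose:
  fixes f P :: "'a::field poly"
  assumes "irreducible P" "f \<noteq> 0"
  obtains k y where "f = P ^ k * y" "\<not> P dvd y"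
proof -
  have "\<exists>k y. f = P ^ k * y \<and> \<not> P dvd y"
    using assms(2)
  proof (induction "degree f" arbitrary: f rule: less_induct)
    case less
    show ?case
    proof (cases "P dvd f")
      case True
      then obtain g where g: "f = P * g" by (rule dvdE)
      then have "P \<noteq> 0" "g \<noteq> 0" using less.prems by auto
      moreover have "degree P > 0"
        using assms(1) \<open>P \<noteq> 0\<close> by (auto simp: irreducible_def is_unit_iff_degree)
      ultimately have "degree g < degree f" by (simp add: g degree_mult_eq)
      then obtain k y where "g = P ^ k * y" "\<not> P dvd y"
        using less.hyps \<open>g \<noteq> 0\<close> by blast
      then show ?thesis by (intro exI[of _ "Suc k"] exI[of _ y]) (simp add: g mult.assoc)
    next
      case False
      then show ?thesis by (intro exI[of _ 0] exI[of _ f]) simp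
    qed
  qed
  with that show ?thesis by blast
qed

lemma coprime_if_no_common_prime_divisor:
  fixes a f :: "'a::{field, finite} poly"
  assumes "f \<noteq> 0" "\<And>P. P \<in> prime_divisors f \<Longrightarrow> \<not> P dvd a"
  shows "coprime a f"
proof (rule coprimeI)
  fix d assume d: "d dvd a" "d dvd f"
  show "is_unit d"
  proof (rule ccontr)
    assume "\<not> is_unit d"
    moreover have "d \<noteq> 0" using d(2) assms(1) by auto
    ultimately obtain P where "lead_coeff P = 1" "irreducible P" "P dvd d"
      by (metis monic_irreducible_divisor_exists)
    then show False using assms(2)[of P] d by (auto simp: prime_divisors_def intro: dvd_trans)
  qed
qed

section \<open>Counting polynomials of bounded degree\<close>

text \<open>\<open>pCons\<close> splits off the constant coefficient, so each increase of the bound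
  multiplies the count by \<open>CARD('a)\<close>.\<close>

lemma card_poly_degree_le:
  "finite {h::'a::{field, finite} poly. degree h \<le> n}"
  "card {h::'a poly. degree h \<le> n} = CARD('a) ^ Suc n"
proof -
  have "finite {h::'a poly. degree h \<le> n} \<and> card {h::'a poly. degree h \<le> n} = CARD('a) ^ Suc n"
  proof (induction n)
    case 0
    have "{h::'a poly. degree h \<le> 0} = range (\<lambda>c. [:c:])"
      by (auto elim: degree_eq_zeroE)
    moreover have "inj (\<lambda>c::'a. [:c:])" by (rule injI) simp
    ultimately show ?case by (simp add: card_image)
  next
    case (Suc n)
    have "{h::'a poly. degree h \<le> Suc n} = (\<lambda>(c, h). pCons c h) ` (UNIV \<times> {h. degree h \<le> n})"
      (is "?A = ?B")
    proof
      show "?A \<subseteq> ?B"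
      proof
        fix h :: "'a poly" assume h: "h \<in> ?A"
        obtain c g where "h = pCons c g" by (rule pCons_cases)
        with h show "h \<in> ?B" by (cases "g = 0") auto
      qed
      show "?B \<subseteq> ?A" by (auto simp: degree_pCons_le intro: le_trans)
    qed
    moreover have "inj_on (\<lambda>(c, h). pCons c h) (UNIV \<times> {h::'a poly. degree h \<le> n})"
      by (auto simp: inj_on_def)
    ultimately show ?case using Suc.IH by (simp add: card_image card_cartesian_product)
  qed
  then show "finite {h::'a poly. degree h \<le> n}"
    "card {h::'a poly. degree h \<le> n} = CARD('a) ^ Suc n" by blast+
qed

section \<open>The unit group modulo \<open>f\<close> and its elements of order at most two\<close>

text \<open>For \<open>degree f \<ge> 1\<close> these are the reduced representatives of the unit
  group of the quotient by \<open>f\<close>; between them congruence is equality.\<close>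

definition unit_residues :: "'a::{field, finite} poly \<Rightarrow> 'a poly set" where
  "unit_residues f = {u. degree u < degree f \<and> coprime u f}"

definition square_roots_of_1 :: "'a::{field, finite} poly \<Rightarrow> 'a poly set" where
  "square_roots_of_1 f = {u \<in> unit_residues f. [u * u = 1] (mod f)}"

lemma finite_unit_residues [simp]: "finite (unit_residues f)"
  by (rule finite_subset[OF _ card_poly_degree_le(1)[of "degree f"]]) (auto simp: unit_residues_def)

lemma finite_square_roots_of_1 [simp]: "finite (square_roots_of_1 f)"
  by (simp add: square_roots_of_1_def)

lemma unit_residues_eqI:
  assumes "u \<in> unit_residues f" "v \<in> unit_residues f" "[u = v] (mod f)"
  shows "u = v"
  using assms by (simp add: unit_residues_def cong_def mod_poly_less)

lemma mod_in_unit_residues: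
  assumes "degree f \<ge> 1" "[a * b = 1] (mod f)"
  shows "a mod f \<in> unit_residues f"
proof -
  have "coprime a f" using assms(2) by (auto simp: coprime_iff_cong_inverse)
  then have "coprime (a mod f) f" using coprime_cong[of "a mod f" a f] by simp
  moreover have "degree (a mod f) < degree f" using degree_mod_less'[of f a] degree_mod_less[of f a] assms(1) by (cases "f = 0") auto
  ultimately show ?thesis by (simp add: unit_residues_def)
qed

text \<open>The square roots of 1 are exactly the fixed points of inversion. Away from them
  inversion pairs units with product 1.\<close>

lemma prod_unit_residues_cong_prod_square_roots:
  assumes "degree f \<ge> 1"
  shows "[\<Prod>(unit_residues f) = \<Prod>(square_roots_of_1 f)] (mod f)"
proof -
  let ?U = "unit_residues f" and ?S = "square_roots_of_1 f"
  \<comment> \<open>Reduction modulo \<open>f\<close> makes the chosen inverse a member of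
    \<open>?U\<close>.\<close>
  define i where "i u = (SOME x. [u * x = 1] (mod f)) mod f" for u
  have inv: "[u * i u = 1] (mod f)" if "u \<in> ?U" for u
  proof -
    have "\<exists>x. [u * x = 1] (mod f)"
      using that by (simp add: unit_residues_def coprime_iff_cong_inverse)
    then have "[u * (SOME x. [u * x = 1] (mod f)) = 1] (mod f)" by (rule someI_ex)
    then show ?thesis unfolding i_def cong_def by (simp add: mod_mult_right_eq)
  qed
  have i_in: "i u \<in> ?U" if "u \<in> ?U" for u
    using mod_in_unit_residues[OF assms, of "i u" u] inv[OF that]
    by (simp add: i_def mult.commute)
  have ii: "i (i u) = u" if "u \<in> ?U" for u
  proof -
    have "[u * 1 = u * (i u * i (i u))] (mod f)"
      using inv[OF i_in[OF that]] by (intro cong_mult cong_refl) (rule cong_sym)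
    also have "u * (i u * i (i u)) = (u * i u) * i (i u)" by (simp add: mult.assoc)
    also have "[\<dots> = 1 * i (i u)] (mod f)"
      using inv[OF that] by (intro cong_mult cong_refl)
    finally show ?thesis
      using unit_residues_eqI[OF that i_in[OF i_in[OF that]]] by simp
  qed
  have "[\<Prod>(?U - ?S) = 1 ^ (card (?U - ?S) div 2)] (mod f)"
  proof (rule cong_prod_involution[where \<phi> = i])
    fix u assume u: "u \<in> ?U - ?S"
    have "i u \<noteq> u" using u inv[of u] by (auto simp: square_roots_of_1_def)
    moreover have "i u \<notin> ?S"
    \<comment> \<open>If \<open>i u\<close> squares to 1, then \<open>u * u\<close> is congruent to
      \<open>(u * i u) * (u * i u)\<close>, hence to 1.\<close>
    proof
      assume "i u \<in> ?S"
      then have "[i u * i u = 1] (mod f)" by (simp add: square_roots_of_1_def)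
      then have "[u * u * (i u * i u) = u * u * 1] (mod f)" by (intro cong_mult cong_refl)
      moreover have "[(u * i u) * (u * i u) = 1 * 1] (mod f)"
        using u by (intro cong_mult inv) auto
      moreover have "u * u * (i u * i u) = (u * i u) * (u * i u)" by (simp add: ac_simps)
      ultimately have "[u * u = 1] (mod f)" by (metis cong_sym cong_trans mult_1_right)
      with u show False by (simp add: square_roots_of_1_def)
    qed
    ultimately show "i u \<in> ?U - ?S \<and> i (i u) = u \<and> i u \<noteq> u" using u i_in ii by simp
    show "[u * i u = 1] (mod f)" using u inv by simp
  qed simp
  then have "[\<Prod>(?U - ?S) * \<Prod>?S = 1 * \<Prod>?S] (mod f)"
    by (intro cong_mult cong_refl) simp
  moreover have "\<Prod>?U = \<Prod>(?U - ?S) * \<Prod>?S"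
    by (rule prod.subset_diff) (auto simp: square_roots_of_1_def)
  ultimately show ?thesis by simp
qed

lemma prod_unit_residues_square:
  assumes "degree f \<ge> 1"
  shows "[\<Prod>(unit_residues f) ^ 2 = 1] (mod f)"
proof -
  have "[\<Prod>(unit_residues f) ^ 2 = \<Prod>(square_roots_of_1 f) ^ 2] (mod f)"
    by (intro cong_pow prod_unit_residues_cong_prod_square_roots assms)
  also have "\<Prod>(square_roots_of_1 f) ^ 2 = (\<Prod>u\<in>square_roots_of_1 f. u * u)"
    by (simp add: power2_eq_square prod.distrib)
  also have "[\<dots> = (\<Prod>u\<in>square_roots_of_1 f. 1)] (mod f)"
    by (intro cong_prod) (simp add: square_roots_of_1_def)
  finally show ?thesis by simp
qed

text \<open>Multiplication by \<open>t\<close> permutes the square roots of 1 without fixed points,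
  and \<open>u * (t * u)\<close> is congruent to \<open>t\<close>. Since \<open>t\<close> is
  arbitrary, different choices can be compared.\<close>

lemma prod_unit_residues_cong_power:
  assumes "degree f \<ge> 1" and t: "[t * t = 1] (mod f)" "\<not> [t = 1] (mod f)"
  shows "[\<Prod>(unit_residues f) = t ^ (card (square_roots_of_1 f) div 2)] (mod f)"
proof -
  let ?S = "square_roots_of_1 f"
  let ?\<phi> = "\<lambda>u. (t * u) mod f"
  have "[\<Prod>?S = t ^ (card ?S div 2)] (mod f)"
  proof (rule cong_prod_involution[where \<phi> = ?\<phi>])
    fix u assume u: "u \<in> ?S"
    have uu: "[u * u = 1] (mod f)" and U: "u \<in> unit_residues f"
      using u by (auto simp: square_roots_of_1_def)
    \<comment> \<open>Being its own inverse, \<open>t * u\<close> is at once a unit and a square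
      root of 1.\<close>
    have tu: "[(t * u) * (t * u) = 1] (mod f)"
      using cong_mult[OF t(1) uu] by (simp add: ac_simps)
    have "[?\<phi> u * ?\<phi> u = (t * u) * (t * u)] (mod f)"
      by (intro cong_mult) simp_all
    then have in_S: "?\<phi> u \<in> ?S"
      using mod_in_unit_residues[OF assms(1) tu] tu
      unfolding square_roots_of_1_def by (auto intro: cong_trans)
    have "?\<phi> (?\<phi> u) = (t * t * u) mod f"
      by (simp add: mod_mult_right_eq mult.assoc)
    also have "\<dots> = u"
      using cong_mult[OF t(1) cong_refl[of u f]] U
      by (simp add: cong_def unit_residues_def mod_poly_less)
    finally have "?\<phi> (?\<phi> u) = u" .
    moreover have "?\<phi> u \<noteq> u"
    proof
      assume "?\<phi> u = u"
      then have "[t * u = u] (mod f)" by (metis cong_mod_right cong_refl)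
      then have "[t * u * u = u * u] (mod f)" by (intro cong_mult cong_refl)
      moreover have "[t * (u * u) = t * 1] (mod f)" using uu by (intro cong_mult cong_refl)
      ultimately have "[t = 1] (mod f)" using uu
        by (metis cong_sym cong_trans mult.assoc mult_1_right)
      with t(2) show False by contradiction
    qed
    ultimately show "?\<phi> u \<in> ?S \<and> ?\<phi> (?\<phi> u) = u \<and> ?\<phi> u \<noteq> u" using in_S by simp
    have "[t * (u * u) = t * 1] (mod f)" using uu by (intro cong_mult cong_refl)
    moreover have "[u * ?\<phi> u = u * (t * u)] (mod f)" by (intro cong_mult) simp_all
    ultimately show "[u * ?\<phi> u = t] (mod f)"
      by (metis cong_trans mult.left_commute mult_1_right)
  qed simp
  with prod_unit_residues_cong_prod_square_roots[OF assms(1)] show ?thesis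
    by (rule cong_trans)
qed

section \<open>Reduction of \<open>G n f\<close> to the product of the unit residues\<close>

text \<open>Division by \<open>f\<close> writes each factor uniquely as \<open>f * h + u\<close>.
  Coprimality constrains only \<open>u\<close>, the degree bound only \<open>h\<close>, so every
  \<open>u\<close> occurs once per quotient \<open>h\<close>.\<close>

lemma G_cong_power:
  fixes f :: "'a::{field, finite} poly"
  assumes "degree f \<ge> 1" "n \<ge> degree f"
  shows "[G n f = \<Prod>(unit_residues f) ^ (CARD('a) ^ Suc (n - degree f))] (mod f)"
proof -
  let ?U = "unit_residues f" and ?H = "{h::'a poly. degree h \<le> n - degree f}"
  let ?F = "\<lambda>(h, u). f * h + u"
  have f0: "f \<noteq> 0" using assms(1) by auto
  have "{g. g \<noteq> 0 \<and> degree g \<le> n \<and> coprime g f} = ?F ` (?H \<times> ?U)" (is "?A = ?B")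
  proof
    show "?A \<subseteq> ?B"
    proof
      fix g assume g: "g \<in> ?A"
      then obtain x where "[g * x = 1] (mod f)" by (auto simp: coprime_iff_cong_inverse)
      then have "g mod f \<in> ?U" by (rule mod_in_unit_residues[OF assms(1)])
      moreover have "g div f \<in> ?H"
      proof (cases "g div f = 0")
        case False
        have "f * (g div f) = g - g mod f" by (simp add: minus_mod_eq_mult_div)
        moreover have "degree (g mod f) \<le> n"
          using degree_mod_less[OF f0, of g] assms(2) by auto
        then have "degree (g - g mod f) \<le> n" using g by (intro degree_diff_le) auto
        ultimately show ?thesis using False f0 degree_mult_eq[of f "g div f"] by simp
      qed simp
      moreover have "g = ?F (g div f, g mod f)" by simp
      ultimately show "g \<in> ?B" by blast
    qed
  next
    show "?B \<subseteq> ?A"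
    proof
      fix g assume "g \<in> ?B"
      then obtain h u where g: "g = f * h + u" "degree h \<le> n - degree f" "u \<in> ?U" by auto
      have "[g = u] (mod f)" using g(1) by (simp add: cong_iff_dvd_diff)
      then have cop: "coprime g f" using g(3) by (simp add: coprime_cong unit_residues_def)
      \<comment> \<open>Zero is not coprime to a non-unit, so \<open>g \<noteq> 0\<close> follows
        from coprimality.\<close>
      moreover have "\<not> is_unit f" using assms(1) f0 by (simp add: is_unit_iff_degree)
      then have "g \<noteq> 0" using cop by auto
      moreover have "degree (f * h) \<le> n"
        using degree_mult_le[of f h] g(2) assms(2) by linarith
      then have "degree g \<le> n"
        unfolding g(1) using g(3) assms(2) by (intro degree_add_le) (auto simp: unit_residues_def)
      ultimately show "g \<in> ?A" by simp
    qed
  qed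
  moreover have "inj_on ?F (?H \<times> ?U)"
  proof (rule inj_onI, clarify)
    fix h u h' u' assume *: "f * h + u = f * h' + u'" "u \<in> ?U" "u' \<in> ?U"
    then have "u - u' = f * (h' - h)" by (simp add: algebra_simps)
    then have "[u = u'] (mod f)" by (simp add: cong_iff_dvd_diff)
    with * have "u = u'" by (intro unit_residues_eqI)
    with *(1) f0 show "h = h' \<and> u = u'" by simp
  qed
  ultimately have "G n f = (\<Prod>(h, u)\<in>?H \<times> ?U. f * h + u)"
    unfolding G_def by (simp only: prod.reindex comp_def)
  also have "\<dots> = (\<Prod>h\<in>?H. \<Prod>u\<in>?U. f * h + u)"
    by (simp add: prod.cartesian_product)
  also have "[\<dots> = (\<Prod>h\<in>?H. \<Prod>u\<in>?U. u)] (mod f)"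
    by (intro cong_prod) (simp add: cong_iff_dvd_diff)
  finally show ?thesis by (simp add: card_poly_degree_le(2))
qed

section \<open>Square roots of 1 when 2 is invertible\<close>

text \<open>If \<open>2 = 0\<close>, then \<open>x \<mapsto> x + 1\<close> is a fixed-point-free
  involution of the field, forcing even cardinality.\<close>

lemma two_neq_0_if_odd_card:
  assumes "odd CARD('a::{field, finite})"
  shows "(2::'a) \<noteq> 0"
proof
  assume 2: "(2::'a) = 0"
  have "x + 1 + 1 = x" for x :: 'a
    using 2 by (simp add: add.assoc)
  then have "even CARD('a)"
    by (intro even_card_involution[where \<phi> = "\<lambda>x. x + 1"]) simp_all
  with assms show False by contradiction
qed

lemma is_unit_poly_2:
  assumes "(2::'a::field) \<noteq> 0"
  shows "is_unit (2 :: 'a poly)"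
proof -
  have "(2 :: 'a poly) = [:2:]" by (rule numeral_poly)
  moreover have "is_unit [:2::'a:]" using assms by (simp only: is_unit_pCons_iff) simp
  ultimately show ?thesis by (simp only:)
qed

lemma minus_1_not_cong_1:
  fixes f :: "'a::field poly"
  assumes "(2::'a) \<noteq> 0" "degree f \<ge> 1"
  shows "\<not> [- 1 = 1] (mod f)"
proof
  assume "[- 1 = 1] (mod f)"
  then have "f dvd 2" by (simp add: cong_iff_dvd_diff)
  then have "is_unit f" using is_unit_poly_2[OF assms(1)] by (rule dvd_unit_imp_unit)
  then show False using assms(2) by (auto elim: is_unit_polyE)
qed

text \<open>\<open>f\<close> divides \<open>(u + 1) * (u - 1)\<close>, and \<open>P\<close> cannot
  divide both factors because their difference 2 is a unit. The factor avoiding \<open>P\<close> is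
  coprime to \<open>f\<close>, so \<open>f\<close> divides the other.\<close>

lemma square_roots_of_1_prime_power:
  fixes f :: "'a::{field, finite} poly"
  assumes "(2::'a) \<noteq> 0" "degree f \<ge> 1" "prime_divisors f = {P}"
  shows "square_roots_of_1 f = {1, -1}"
proof
  have f0: "f \<noteq> 0" using assms(2) by auto
  have one: "1 \<in> unit_residues f" "-1 \<in> unit_residues f"
    using assms(2) by (simp_all add: unit_residues_def is_unit_left_imp_coprime)
  then show "{1, -1} \<subseteq> square_roots_of_1 f" by (simp add: square_roots_of_1_def)
  show "square_roots_of_1 f \<subseteq> {1, -1}"
  proof
    fix u assume "u \<in> square_roots_of_1 f"
    then have u: "u \<in> unit_residues f" and "f dvd u * u - 1"
      by (auto simp: square_roots_of_1_def cong_iff_dvd_diff)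
    then have dvd: "f dvd (u + 1) * (u - 1)" by (simp add: algebra_simps)
    have "\<not> (P dvd u + 1 \<and> P dvd u - 1)"
    proof
      assume "P dvd u + 1 \<and> P dvd u - 1"
      then have "P dvd (u + 1) - (u - 1)" by (elim conjE) (rule dvd_diff)
      also have "(u + 1) - (u - 1) = 2" by simp
      finally have "P dvd 2" .
      then have "is_unit P" using is_unit_poly_2[OF assms(1)] by (rule dvd_unit_imp_unit)
      moreover have "irreducible P" using assms(3) by (auto simp: prime_divisors_def)
      ultimately show False by (simp add: irreducible_def)
    qed
    moreover have "coprime a f" if "\<not> P dvd a" for a
      by (rule coprime_if_no_common_prime_divisor[OF f0]) (use that assms(3) in simp)
    ultimately consider "coprime (u + 1) f" | "coprime (u - 1) f" by blast
    then have "f dvd u - 1 \<or> f dvd u - (-1)"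
    proof cases
      case 1
      then show ?thesis using coprime_dvd_multD[OF _ dvd] by simp
    next
      case 2
      moreover have "f dvd (u - 1) * (u + 1)" using dvd by (simp only: mult.commute)
      ultimately have "f dvd u + 1" by (rule coprime_dvd_multD)
      then show ?thesis by simp
    qed
    then have "[u = 1] (mod f) \<or> [u = -1] (mod f)" by (simp only: cong_iff_dvd_diff)
    then show "u \<in> {1, -1}" using unit_residues_eqI[OF u one(1)] unit_residues_eqI[OF u one(2)] by auto
  qed
qed

text \<open>Write \<open>f = P ^ k * y\<close> with coprime factors and choose \<open>e\<close>
  congruent to -1 modulo \<open>P ^ k\<close> and to 1 modulo \<open>y\<close>. Then
  \<open>P\<close> witnesses that \<open>e\<close> is not 1, and \<open>Q\<close>, which divides
  \<open>y\<close>, that it is not -1.\<close>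

lemma nontrivial_square_root_of_1:
  fixes f :: "'a::{field, finite} poly"
  assumes "(2::'a) \<noteq> 0" "f \<noteq> 0" "P \<in> prime_divisors f" "Q \<in> prime_divisors f" "P \<noteq> Q"
  obtains e where "[e * e = 1] (mod f)" "\<not> [e = 1] (mod f)" "\<not> [e = -1] (mod f)"
proof -
  note unit2 = is_unit_poly_2[OF assms(1)]
  have P: "lead_coeff P = 1" "irreducible P" "P dvd f" "prime_elem P"
    and Q: "lead_coeff Q = 1" "irreducible Q" "Q dvd f" "prime_elem Q"
    using assms(3,4) by (auto simp: prime_divisors_def field_poly_irreducible_imp_prime)
  \<comment> \<open>The cofactor is a constant unit, and comparing leading coefficients makes it
    1.\<close>
  have dvd_P: "R = P" if R: "lead_coeff R = 1" "irreducible R" "R dvd P" for R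
  proof -
    obtain c where c: "P = R * c" using R(3) by (rule dvdE)
    then have "is_unit c" using P(2) R(2) by (auto simp: irreducible_def)
    then obtain a where a: "c = [:a:]" by (auto elim: is_unit_polyE)
    have "lead_coeff c = 1" using c P(1) R(1) by (simp add: lead_coeff_mult)
    then have "a = 1" using a by simp
    with a c show ?thesis by simp
  qed
  obtain k y where fk: "f = P ^ k * y" and y: "\<not> P dvd y"
    using irreducible_power_decompose[OF P(2) assms(2)] by blast
  have y0: "y \<noteq> 0" using fk assms(2) by auto
  have k: "k \<noteq> 0" using fk y P(3) by (cases "k = 0") auto
  have "coprime (P ^ k) y"
  proof (rule coprime_if_no_common_prime_divisor[OF y0])
    fix R assume R: "R \<in> prime_divisors y"
    show "\<not> R dvd P ^ k"
    proof
      assume "R dvd P ^ k"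
      then have "R dvd P" using R
        by (auto simp: prime_divisors_def dest: prime_elem_dvd_power field_poly_irreducible_imp_prime)
      then have "R = P" using R dvd_P by (simp add: prime_divisors_def)
      then show False using R y by (simp add: prime_divisors_def)
    qed
  qed
  then obtain a b where ab: "P ^ k * a + y * b = 1" by (rule coprime_bezout)
  \<comment> \<open>Flipping one sign in the Bezout identity gives
    \<open>e - 1 = - (2 * (y * b))\<close> and \<open>e + 1 = 2 * (P ^ k * a)\<close>; their product
    is a multiple of \<open>f\<close>.\<close>
  define e where "e = P ^ k * a - y * b"
  have "e - 1 = e - (P ^ k * a + y * b)" by (simp only: ab)
  then have e1: "e - 1 = - (2 * (y * b))" by (simp add: e_def algebra_simps)
  have "e - (-1) = e + (P ^ k * a + y * b)" by (simp add: ab)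
  then have e2: "e - (-1) = 2 * (P ^ k * a)" unfolding e_def by (simp add: algebra_simps)
  have "e * e - 1 = (e - (-1)) * (e - 1)" by (simp add: algebra_simps)
  also have "\<dots> = f * (- (4 * (a * b)))" unfolding e1 e2 fk by (simp add: algebra_simps)
  finally have "[e * e = 1] (mod f)" by (simp add: cong_iff_dvd_diff)
  moreover have "\<not> [e = 1] (mod f)"
  \<comment> \<open>Otherwise \<open>P\<close> divides both terms of the Bezout identity, the second
    because 2 is a unit, and hence divides 1.\<close>
  proof
    assume "[e = 1] (mod f)"
    then have "f dvd 2 * (y * b)" by (simp add: cong_iff_dvd_diff e1)
    then have "P dvd 2 * (y * b)" using P(3) by (rule dvd_trans[rotated])
    then have "P dvd y * b" using unit2 by (simp add: dvd_mult_unit_iff')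
    moreover have "P dvd P ^ k * a" using k by (simp add: dvd_power dvd_mult2)
    ultimately have "P dvd P ^ k * a + y * b" by (rule dvd_add[rotated])
    with ab P(2) show False by (simp add: irreducible_def)
  qed
  moreover have "\<not> [e = -1] (mod f)"
  proof
    have "\<not> Q dvd P ^ k"
      using Q dvd_P assms(5) by (auto dest: prime_elem_dvd_power)
    then have "Q dvd y * b" using Q fk by (auto dest: prime_elem_dvd_multD)
    assume "[e = -1] (mod f)"
    then have "f dvd 2 * (P ^ k * a)" by (simp only: cong_iff_dvd_diff e2)
    then have "Q dvd 2 * (P ^ k * a)" using Q(3) by (rule dvd_trans[rotated])
    then have "Q dvd P ^ k * a" using unit2 by (simp add: dvd_mult_unit_iff')
    then have "Q dvd P ^ k * a + y * b" using \<open>Q dvd y * b\<close> by (rule dvd_add)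
    with ab Q(2) show False by (simp add: irreducible_def)
  qed
  ultimately show ?thesis by (rule that)
qed

section \<open>Wilson's theorem modulo \<open>f\<close> and the final parity argument\<close>

lemma prod_unit_residues_cong:
  fixes f :: "'a::{field, finite} poly"
  assumes "(2::'a) \<noteq> 0" "degree f \<ge> 1"
  shows "[\<Prod>(unit_residues f) = (if card (prime_divisors f) = 1 then -1 else 1)] (mod f)"
proof (cases "card (prime_divisors f) = 1")
  case True
  then obtain P where "prime_divisors f = {P}" by (rule card_1_singletonE)
  then have "square_roots_of_1 f = {1, -1}"
    using square_roots_of_1_prime_power[OF assms] by blast
  \<comment> \<open>Distinctness keeps \<open>{1, -1}\<close> from collapsing to \<open>{1}\<close>,
    whose product would be 1.\<close>
  moreover have "(1::'a poly) \<noteq> -1"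
    using minus_1_not_cong_1[OF assms] by (auto simp: cong_def)
  ultimately have "\<Prod>(square_roots_of_1 f) = -1" by simp
  then show ?thesis using prod_unit_residues_cong_prod_square_roots[OF assms(2)] True by simp
next
  case False
  let ?k = "card (square_roots_of_1 f) div 2"
  have f0: "f \<noteq> 0" using assms(2) by auto
  then have "\<not> is_unit f" using assms(2) by (simp add: is_unit_iff_degree)
  then obtain P where "lead_coeff P = 1" "irreducible P" "P dvd f"
    by (rule monic_irreducible_divisor_exists[OF f0])
  then have P: "P \<in> prime_divisors f" by (simp add: prime_divisors_def)
  have "prime_divisors f \<noteq> {P}" using False by auto
  with P obtain Q where "Q \<in> prime_divisors f" "P \<noteq> Q" by blast
  then obtain e where e: "[e * e = 1] (mod f)" "\<not> [e = 1] (mod f)" "\<not> [e = -1] (mod f)"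
    by (rule nontrivial_square_root_of_1[OF assms(1) f0 P])
  have W: "[\<Prod>(unit_residues f) = (-1) ^ ?k] (mod f)"
    by (rule prod_unit_residues_cong_power[OF assms(2)])
      (use minus_1_not_cong_1[OF assms] in simp_all)
  \<comment> \<open>For odd \<open>?k\<close> the choice \<open>t = e\<close> makes the product
    congruent to \<open>e\<close>, while \<open>t = -1\<close> makes it congruent to -1.\<close>
  have "even ?k"
  proof (rule ccontr)
    assume "odd ?k"
    then obtain j where j: "?k = 2 * j + 1" by (rule oddE)
    have "[1 ^ j * e = (e * e) ^ j * e] (mod f)"
      using cong_sym[OF e(1)] by (intro cong_mult cong_pow cong_refl)
    also have "(e * e) ^ j * e = e ^ ?k"
      unfolding j by (simp add: power_mult power2_eq_square)
    also have "[e ^ ?k = \<Prod>(unit_residues f)] (mod f)"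
      by (rule cong_sym[OF prod_unit_residues_cong_power[OF assms(2) e(1,2)]])
    also have "[\<Prod>(unit_residues f) = -1] (mod f)"
      using W \<open>odd ?k\<close> by simp
    finally have "[e = -1] (mod f)" by simp
    with e(3) show False by contradiction
  qed
  with W False show ?thesis by simp
qed

theorem theorem3p3:
  fixes p s n :: nat
    and f :: "'a::{field, finite} poly"
  assumes "prime p"
    and "s \<ge> 1"
    and "CARD('a) = p ^ s"
    and "degree f \<ge> 1"
    and "n \<ge> degree f"
  shows "[G n f = (if odd p \<and> card (prime_divisors f) = 1 then -1 else 1)] (mod f)"
proof -
  let ?W = "\<Prod>(unit_residues f)" and ?N = "CARD('a) ^ Suc (n - degree f)"
  have G: "[G n f = ?W ^ ?N] (mod f)" by (rule G_cong_power[OF assms(4,5)])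
  have sq: "[(?W ^ 2) ^ j = 1 ^ j] (mod f)" for j
    by (intro cong_pow prod_unit_residues_square assms(4))
  show ?thesis
  proof (cases "odd p")
    case True
    then have odd: "odd CARD('a)" by (simp add: assms(3))
    then have "odd ?N" by simp
    then obtain j where j: "?N = 2 * j + 1" by (rule oddE)
    \<comment> \<open>As \<open>?W\<close> squares to 1, an odd exponent leaves \<open>?W\<close>
      itself.\<close>
    have "?W ^ ?N = (?W ^ 2) ^ j * ?W" unfolding j by (simp add: power_mult)
    also have "[\<dots> = 1 ^ j * ?W] (mod f)" by (intro cong_mult sq cong_refl)
    also have "[1 ^ j * ?W = (if card (prime_divisors f) = 1 then -1 else 1)] (mod f)"
      using prod_unit_residues_cong[OF two_neq_0_if_odd_card[OF odd] assms(4)] by simp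
    finally show ?thesis using G True by (auto intro: cong_trans)
  next
    case False
    \<comment> \<open>Here \<open>p\<close> is even; \<open>s \<ge> 1\<close> makes
      \<open>CARD('a)\<close> even, and the exponent \<open>Suc (n - degree f)\<close> is
      positive.\<close>
    then have "even ?N" using assms(2,3) by simp
    then obtain j where "?N = 2 * j" by (rule evenE)
    then have "[?W ^ ?N = 1] (mod f)" using sq[of j] by (simp add: power_mult)
    then show ?thesis using G False by (auto intro: cong_trans)
  qed
qed

end
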